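(* For all integers $n$ and $k$ with $2\leq k\leq \lfloor n/2\rfloor$ there exists a graph $G$ of order $n$ with $$\delta(G)=\left\lceil \frac{n}{2}\right\rceil+\left\lfloor \frac{k}{2}\right\rfloor-2$$ such that $G$ is not a $k$-ordered Hamiltonian graph.
   Context: $\delta(G)$ denotes the minimum degree of $G$. A graph is Hamiltonian if it contains a cycle through all its vertices. For a sequence $S=v_1,\ldots,v_k$ of $k$ distinct vertices, a cycle is an $S$-cycle if it encounters $v_1,\ldots,v_k$ in this order. A Hamiltonian graph $G$ of order $n$ is $k$-ordered if for every sequence $S$ of $k$ distinct vertices of $G$ there is a Hamiltonian cycle of $G$ that is an $S$-cycle; "$k$-ordered Hamiltonian graph" means a Hamiltonian graph which is $k$-ordered. *)

theory Defs
  imports Complex_Main "HOL-Library.Sublist" "Graph_Theory.Pair_Digraph"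
begin

text \<open>
  Finite simple graphs are represented by the locale \<^locale>\<open>pair_graph\<close>: finite loop-free
  symmetric digraphs whose arcs are pairs of vertices, so each edge is a pair of opposite arcs.
  The degree of a vertex is therefore its out-degree.
\<close>

text \<open>Only meaningful for graphs with at least one vertex.\<close>

definition min_degree :: "'a pair_pre_digraph \<Rightarrow> nat" where
  "min_degree G = Min (out_degree (with_proj G) ` pverts G)"

text \<open>
  In a symmetric digraph the closed walk \<open>u, v, u\<close> satisfies \<^const>\<open>pre_digraph.cycle\<close>.
  The length bound excludes it, since it is not a cycle of the underlying graph.
\<close>

definition graph_cycle :: "'a pair_pre_digraph \<Rightarrow> ('a \<times> 'a) awalk \<Rightarrow> bool" where
  "graph_cycle G p \<longleftrightarrow> pre_digraph.cycle (with_proj G) p \<and> length p \<ge> 3"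

text \<open>The list of tails of a cycle's arcs names each of its vertices once, in cyclic order.\<close>

definition cycle_verts :: "('a \<times> 'a) awalk \<Rightarrow> 'a list" where
  "cycle_verts p = map fst p"

definition hamiltonian_cycle :: "'a pair_pre_digraph \<Rightarrow> ('a \<times> 'a) awalk \<Rightarrow> bool" where
  "hamiltonian_cycle G p \<longleftrightarrow> graph_cycle G p \<and> set (cycle_verts p) = pverts G"

definition hamiltonian :: "'a pair_pre_digraph \<Rightarrow> bool" where
  "hamiltonian G \<longleftrightarrow> (\<exists>p. hamiltonian_cycle G p)"

text \<open>
  A cycle of an undirected graph has neither a distinguished starting point nor a distinguished
  direction, so it may be traversed from any vertex and either way round.
\<close>

definition encounters_in_order :: "('a \<times> 'a) awalk \<Rightarrow> 'a list \<Rightarrow> bool" where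
  "encounters_in_order p S \<longleftrightarrow>
     (\<exists>i. subseq S (rotate i (cycle_verts p)) \<or> subseq S (rotate i (rev (cycle_verts p))))"

definition k_ordered_hamiltonian :: "nat \<Rightarrow> 'a pair_pre_digraph \<Rightarrow> bool" where
  "k_ordered_hamiltonian k G \<longleftrightarrow>
     hamiltonian G \<and>
     (\<forall>S. length S = k \<and> distinct S \<and> set S \<subseteq> pverts G \<longrightarrow>
          (\<exists>p. hamiltonian_cycle G p \<and> encounters_in_order p S))"

end

theory Submission
  imports Defs
begin

text \<open>
  Let two cliques of nearly equal size share a set \<open>X\<close> of \<open>2h - 1\<close> vertices, where
  \<open>h = \<lfloor>k/2\<rfloor>\<close>, and let the first \<open>2h\<close> entries of \<open>S\<close> alternate between the two sides outside
  \<open>X\<close>. An \<open>S\<close>-cycle has to change sides \<open>2h\<close> times, and each change uses a vertex of \<open>X\<close> of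
  its own.
\<close>

section \<open>Separating vertices along an open walk\<close>

text \<open>A step between two vertices outside \<open>X\<close> preserves \<open>f\<close>, so a
  walk whose ends lie outside \<open>X\<close> and differ in \<open>f\<close> must enter
  \<open>X\<close> in between.\<close>

lemma successively_meets_separator:
  assumes "successively R (s # us @ [t])"
    and "\<And>u v. R u v \<Longrightarrow> X u \<or> X v \<or> f u = f v"
    and "\<not> X s" "\<not> X t" "f s \<noteq> f t"
  shows "\<exists>z\<in>set us. X z"
  using assms
proof (induction us arbitrary: s)
  case Nil
  then show ?case by auto
next
  case (Cons u us)
  show ?case
  proof (cases "X u")
    case False
    then have "f s = f u" using Cons.prems by auto
    then show ?thesis using Cons.IH[of u] Cons.prems False by auto
  qed simp
qed

text \<open>Each of the \<open>length T - 1\<close> gaps between consecutive entries of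
  \<open>T\<close> contains a vertex of \<open>X\<close>, and the gaps are disjoint stretches of
  \<open>L\<close>.\<close>

lemma alternating_subseq_length_le:
  assumes "subseq T L" and "successively R L"
    and "\<And>u v. R u v \<Longrightarrow> X u \<or> X v \<or> f u = f v"
    and "\<forall>t\<in>set T. \<not> X t" and "successively (\<lambda>u v. f u \<noteq> f v) T"
  shows "length T \<le> Suc (length (filter X L))"
  using assms(1,2,4,5)
proof (induction T arbitrary: L rule: induct_list012)
  case (3 t1 t2 T)
  obtain us vs where L: "L = us @ t1 # vs" and "subseq (t2 # T) vs"
    using list_emb_ConsD[OF "3.prems"(1)] by auto
  then obtain ws vs' where vs: "vs = ws @ t2 # vs'" and sub: "subseq T vs'"
    using list_emb_ConsD[of "(=)" t2 T vs] by auto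
  have "successively R ((t1 # ws @ [t2]) @ vs')" and tail: "successively R (t2 # vs')"
    using "3.prems"(2) unfolding L vs
    by (auto simp: successively_append_iff successively_Cons split: if_splits)
  then have "successively R (t1 # ws @ [t2])"
    using successively_append_iff by blast
  then obtain z where "z \<in> set ws" "X z"
    using successively_meets_separator[of R t1 ws t2 X f] assms(3) "3.prems"(3,4) by auto
  then have "filter X ws \<noteq> []"
    by (auto simp: filter_empty_conv)
  then have "length (filter X ws) \<ge> 1"
    by (cases "filter X ws") auto
  \<comment> \<open>The remainder starts at \<open>t2\<close>, after the gap \<open>ws\<close>, so
    the \<open>X\<close>-vertex found in \<open>ws\<close> is not counted again.\<close>
  moreover have "length (t2 # T) \<le> Suc (length (filter X (t2 # vs')))"
    using "3.IH"(2)[of "t2 # vs'"] sub tail "3.prems"(3,4) by auto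
  ultimately show ?case
    by (simp add: L vs)
qed auto

section \<open>Separating vertices along a cycle\<close>

text \<open>Repeating the head at the end turns the wrap-around into an ordinary step, so results
  about \<open>successively\<close> apply.\<close>

definition cyclically :: "('a \<Rightarrow> 'a \<Rightarrow> bool) \<Rightarrow> 'a list \<Rightarrow> bool" where
  "cyclically R c \<longleftrightarrow> c = [] \<or> successively R (c @ [hd c])"

lemma cyclically_append_commute:
  assumes "cyclically R (us @ vs)"
  shows "cyclically R (vs @ us)"
  using assms unfolding cyclically_def
  by (cases "us = [] \<or> vs = []") (auto simp: successively_append_iff)

lemma cyclically_rotate: "cyclically R c \<Longrightarrow> cyclically R (rotate i c)"
  by (metis append_take_drop_id cyclically_append_commute rotate_drop_take)

lemma cyclically_rev:
  assumes "symp R" "cyclically R c"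
  shows "cyclically R (rev c)"
proof (cases c)
  case (Cons x xs)
  have "successively R (rev (x # xs @ [x]))"
    using assms Cons unfolding successively_rev cyclically_def
    by (auto elim!: successively_mono dest: sympD)
  then have "cyclically R ([x] @ rev xs)"
    by (simp add: cyclically_def)
  then show ?thesis
    using cyclically_append_commute[of R "[x]" "rev xs"] Cons by simp
qed (simp add: cyclically_def)

text \<open>On a cycle the gap from the last entry of \<open>T\<close> back to the first counts too,
  which improves the linear bound by one.\<close>

lemma cyclically_alternating_subseq_length_le:
  assumes "cyclically R c" and "subseq T c"
    and R: "\<And>u v. R u v \<Longrightarrow> X u \<or> X v \<or> f u = f v"
    and "\<forall>t\<in>set T. \<not> X t" and "cyclically (\<lambda>u v. f u \<noteq> f v) T"
  shows "length T \<le> length (filter X c)"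
proof (cases T)
  case (Cons t T')
  obtain us vs where c: "c = us @ t # vs" and sub: "subseq T' vs"
    using assms(2) Cons list_emb_ConsD by fastforce
  \<comment> \<open>The cycle is cut open at the first entry of \<open>T\<close>. The extra copy of
    \<open>t\<close> is outside \<open>X\<close>, so it lengthens \<open>T\<close> without changing
    the count in \<open>X\<close>.\<close>
  let ?L = "(t # vs @ us) @ [t]"
  have "cyclically R (t # vs @ us)"
    using cyclically_append_commute[of R us "t # vs"] assms(1) c by simp
  then have "successively R ?L"
    by (simp add: cyclically_def)
  moreover have "subseq (T @ [t]) ?L"
    using sub Cons list_emb_append_mono[of "(=)" T' "vs @ us" "[t]" "[t]"]
    by (simp add: list_emb_append2 subseq_rev_drop_many)
  ultimately have "length (T @ [t]) \<le> Suc (length (filter X ?L))"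
    using alternating_subseq_length_le[of "T @ [t]" ?L R X f] assms(4,5) R Cons
    by (auto simp: cyclically_def)
  then show ?thesis
    using assms(4) Cons c by auto
qed simp

section \<open>From arc walks to cyclic vertex lists\<close>

lemma awalk_verts_eq_map_fst:
  "pre_digraph.cas (with_proj G) u p v \<Longrightarrow>
    pre_digraph.awalk_verts (with_proj G) u p = map fst p @ [v]"
  by (induction p arbitrary: u) (auto simp: pre_digraph.cas.simps pre_digraph.awalk_verts.simps)

lemma cyclically_cycle_verts:
  assumes "pre_digraph.cycle (with_proj G) p"
  shows "cyclically (\<lambda>u v. (u, v) \<in> parcs G) (cycle_verts p)"
proof -
  \<comment> \<open>The second conjunct identifies the end vertex of a closed walk with the head of
    its list of tails, as \<open>cyclically\<close> requires.\<close>
  have walk: "successively (\<lambda>u v. (u, v) \<in> parcs G) (map fst p @ [v]) \<and> (p \<noteq> [] \<longrightarrow> fst (hd p) = u)"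
    if "pre_digraph.cas (with_proj G) u p v" "set p \<subseteq> parcs G" for u v p
    using that
  proof (induction p arbitrary: u)
    case (Cons e p)
    then show ?case
      by (cases p) (auto simp: pre_digraph.cas.simps successively_Cons)
  qed (simp add: pre_digraph.cas.simps)
  obtain u where "pre_digraph.cas (with_proj G) u p u" "set p \<subseteq> parcs G" "p \<noteq> []"
    using assms by (auto simp: pre_digraph.cycle_def pre_digraph.awalk_def)
  with walk[of u p u] show ?thesis
    by (auto simp: cyclically_def cycle_verts_def hd_map)
qed

section \<open>The overlapping cliques and their degrees\<close>

text \<open>The shared vertices are those below \<open>x\<close>; the two sides are told apart by parity.\<close>

definition overlapping_cliques :: "nat \<Rightarrow> nat \<Rightarrow> nat pair_pre_digraph" where
  "overlapping_cliques n x =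
     \<lparr>pverts = {..<n},
      parcs = {(u, v). u < n \<and> v < n \<and> u \<noteq> v \<and> (u < x \<or> v < x \<or> even u = even v)}\<rparr>"

lemma pair_graph_overlapping_cliques: "pair_graph (overlapping_cliques n x)"
proof
  show "finite (parcs (overlapping_cliques n x))"
    by (rule finite_subset[of _ "{..<n} \<times> {..<n}"]) (auto simp: overlapping_cliques_def)
qed (auto simp: overlapping_cliques_def symmetric_def sym_def)

lemma card_even_atLeastLessThan: "card {v \<in> {2 * a - 1..<n}. even v} = (n + 1) div 2 - a"
proof -
  have "v \<in> (*) 2 ` {a..<(n + 1) div 2}" if "v \<in> {v \<in> {2 * a - 1..<n}. even v}" for v
    using that by (intro image_eqI[of _ _ "v div 2"]) auto
  then have "{v \<in> {2 * a - 1..<n}. even v} = (*) 2 ` {a..<(n + 1) div 2}"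
    by auto
  then show ?thesis
    by (simp add: card_image inj_on_def)
qed

lemma card_odd_atLeastLessThan: "card {v \<in> {2 * a - 1..<n}. odd v} = n div 2 - (a - 1)"
proof -
  have "v \<in> (\<lambda>i. 2 * i + 1) ` {a - 1..<n div 2}" if "v \<in> {v \<in> {2 * a - 1..<n}. odd v}" for v
    using that by (intro image_eqI[of _ _ "v div 2"]) (auto, presburger)
  then have "{v \<in> {2 * a - 1..<n}. odd v} = (\<lambda>i. 2 * i + 1) ` {a - 1..<n div 2}"
    by auto
  then show ?thesis
    by (simp add: card_image inj_on_def)
qed

text \<open>A shared vertex is adjacent to all others; any other vertex sees the shared set and its
  own side, less itself.\<close>

lemma out_degree_overlapping_cliques:
  assumes "u < n" "x \<le> n"
  shows "out_degree (with_proj (overlapping_cliques n x)) u =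
    (if u < x then n - 1 else x + card {v \<in> {x..<n}. even v = even u} - 1)"
proof -
  let ?N = "{v. v < n \<and> u \<noteq> v \<and> (u < x \<or> v < x \<or> even u = even v)}"
  have "out_arcs (with_proj (overlapping_cliques n x)) u = Pair u ` ?N"
    using assms by (auto simp: out_arcs_def overlapping_cliques_def)
  then have deg: "out_degree (with_proj (overlapping_cliques n x)) u = card ?N"
    by (simp add: out_degree_def card_image inj_on_def)
  show ?thesis
  proof (cases "u < x")
    case True
    then have "?N = {..<n} - {u}" by auto
    then show ?thesis using deg True assms by simp
  next
    case False
    let ?C = "{v \<in> {x..<n}. even v = even u}"
    have "?N = ({..<x} \<union> ?C) - {u}" using False assms by auto
    moreover have "u \<in> {..<x} \<union> ?C" using False assms by auto
    moreover have "card ({..<x} \<union> ?C) = x + card ?C"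
      by (subst card_Un_disjoint) auto
    ultimately show ?thesis using deg False by simp
  qed
qed

text \<open>The shared set \<open>0, ..., 2 * h - 2\<close> takes \<open>h\<close> even but only
  \<open>h - 1\<close> odd numbers, so the even side is never the larger one and attains the
  minimum.\<close>

lemma min_degree_overlapping_cliques:
  assumes "1 \<le> h" "2 * h \<le> n - 1"
  shows "min_degree (overlapping_cliques n (2 * h - 1)) = (n + 1) div 2 + h - 2"
proof -
  define G where "G = overlapping_cliques n (2 * h - 1)"
  have V: "pverts G = {..<n}"
    by (simp add: G_def overlapping_cliques_def)
  have deg: "out_degree (with_proj G) u =
      (if u < 2 * h - 1 then n - 1 else if even u then (n + 1) div 2 + h - 2 else n div 2 + h - 1)"
    if "u < n" for u
    using that assms card_even_atLeastLessThan[of h n] card_odd_atLeastLessThan[of h n]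
    by (auto simp: G_def out_degree_overlapping_cliques) arith+
  have "Min (out_degree (with_proj G) ` {..<n}) = (n + 1) div 2 + h - 2"
  proof (rule Min_eqI)
    show "(n + 1) div 2 + h - 2 \<le> d" if "d \<in> out_degree (with_proj G) ` {..<n}" for d
      using that assms by (auto simp: deg)
    \<comment> \<open>\<open>2 * h\<close> is the first even vertex outside the shared set.\<close>
    show "(n + 1) div 2 + h - 2 \<in> out_degree (with_proj G) ` {..<n}"
      using assms by (intro image_eqI[of _ _ "2 * h"]) (auto simp: deg)
  qed simp
  then show ?thesis
    by (simp only: min_degree_def G_def[symmetric] V)
qed

lemma not_k_ordered_overlapping_cliques:
  assumes "1 \<le> h" "2 * h \<le> k" "2 * h - 1 + k \<le> n"
  shows "\<not> k_ordered_hamiltonian k (overlapping_cliques n (2 * h - 1))"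
proof
  let ?x = "2 * h - 1"
  let ?G = "overlapping_cliques n ?x"
  let ?R = "\<lambda>u v. (u, v) \<in> parcs ?G"
  \<comment> \<open>Consecutive integers alternate in parity, and the even length
    \<open>2 * h\<close> makes the last and first entries differ as well.\<close>
  let ?T = "[?x..<?x + 2 * h]"
  let ?S = "[?x..<?x + k]"
  assume "k_ordered_hamiltonian k ?G"
  moreover have "length ?S = k \<and> distinct ?S \<and> set ?S \<subseteq> pverts ?G"
    using assms by (auto simp: overlapping_cliques_def)
  ultimately obtain p where p: "hamiltonian_cycle ?G p" and enc: "encounters_in_order p ?S"
    unfolding k_ordered_hamiltonian_def by blast
  have cyc: "cyclically ?R (cycle_verts p)"
    using p by (auto simp: hamiltonian_cycle_def graph_cycle_def intro: cyclically_cycle_verts)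
  have dist: "distinct (cycle_verts p)"
  proof -
    \<comment> \<open>\<open>cycle\<close> asks for distinctness only after dropping the start
      vertex, which recurs at the end; the remaining list is a rotation of
      \<open>cycle_verts p\<close>.\<close>
    obtain u where u: "pre_digraph.cas (with_proj ?G) u p u" "p \<noteq> []"
      "distinct (tl (pre_digraph.awalk_verts (with_proj ?G) u p))"
      using p by (auto simp: hamiltonian_cycle_def graph_cycle_def pre_digraph.cycle_def
          pre_digraph.awalk_def)
    then have "fst (hd p) = u"
      by (cases p) (auto simp: pre_digraph.cas.simps)
    with u show ?thesis
      by (cases p) (auto simp: awalk_verts_eq_map_fst cycle_verts_def)
  qed
  have "symp ?R"
    by (auto simp: symp_def overlapping_cliques_def)
  then have rev: "cyclically ?R (rev (cycle_verts p))"
    using cyc cyclically_rev by blast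
  \<comment> \<open>Rotation and reversal preserve cyclic adjacency and distinctness, so a single
    \<open>c\<close> covers every start and both directions.\<close>
  obtain c where c: "cyclically ?R c" "distinct c" and sub: "subseq ?S c"
    using enc cyc rev dist unfolding encounters_in_order_def
    by (metis cyclically_rotate distinct_rev distinct_rotate)
  have "?S = ?T @ [?x + 2 * h..<?x + k]"
    using assms by (metis le_add1 add_le_cancel_left le_add_diff_inverse upt_add_eq_append)
  then have "subseq ?T c"
    using sub by (metis subseq_order.order_trans subseq_rev_drop_many prefix_imp_subseq prefixI)
  moreover have "cyclically (\<lambda>u v. even u \<noteq> even v) ?T"
    using assms(1) by (auto simp: cyclically_def successively_conv_nth nth_append)
  ultimately have "length ?T \<le> length (filter (\<lambda>v. v < ?x) c)"
    using c by (intro cyclically_alternating_subseq_length_le[where R = ?R and f = even])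
      (auto simp: overlapping_cliques_def)
  \<comment> \<open>As \<open>c\<close> visits each vertex at most once, it has at most
    \<open>2 * h - 1\<close> shared entries, one fewer than \<open>?T\<close> demands.\<close>
  also have "\<dots> = card (set (filter (\<lambda>v. v < ?x) c))"
    using c by (metis distinct_card distinct_filter)
  also have "\<dots> \<le> card {..<?x}"
    by (intro card_mono) auto
  finally show False
    using assms by simp
qed

theorem theorem2:
  fixes n k :: nat
  assumes "2 \<le> k" and "int k \<le> \<lfloor>real n / 2\<rfloor>"
  shows "\<exists>G :: nat pair_pre_digraph.
           pair_graph G \<and> card (pverts G) = n \<and>
           int (min_degree G) = \<lceil>real n / 2\<rceil> + \<lfloor>real k / 2\<rfloor> - 2 \<and>
           \<not> k_ordered_hamiltonian k G"
proof -
  define h where "h = k div 2"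
  have h: "1 \<le> h" "2 * h \<le> k"
    using assms by (auto simp: h_def)
  have "2 * k \<le> n"
    using assms(2) by linarith
  let ?G = "overlapping_cliques n (2 * h - 1)"
  have "\<lfloor>real k / 2\<rfloor> = int h"
    using floor_divide_of_nat_eq[of k 2] by (simp add: h_def)
  moreover have "\<lceil>real n / 2\<rceil> = int ((n + 1) div 2)"
    by (cases "even n") (auto elim!: evenE oddE simp: ceiling_eq_iff)
  moreover have "min_degree ?G = (n + 1) div 2 + h - 2"
    using h \<open>2 * k \<le> n\<close> by (intro min_degree_overlapping_cliques) auto
  \<comment> \<open>Here \<open>n \<ge> 4\<close> and \<open>h \<ge> 1\<close>, so the
    natural-number subtraction of 2 is not truncated and agrees with the integer one.\<close>
  ultimately have "int (min_degree ?G) = \<lceil>real n / 2\<rceil> + \<lfloor>real k / 2\<rfloor> - 2"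
    using h \<open>2 * k \<le> n\<close> by auto
  moreover have "\<not> k_ordered_hamiltonian k ?G"
    using h \<open>2 * k \<le> n\<close> by (intro not_k_ordered_overlapping_cliques) auto
  moreover have "card (pverts ?G) = n"
    by (simp add: overlapping_cliques_def)
  ultimately show ?thesis
    using pair_graph_overlapping_cliques by blast
qed

end
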